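(* Let $\ell$ be a positive integer. Then there exists a positive integer $k$ such that the following holds for every positive integer $n$. Let $\mathcal{F}\subset \{0,1\}^{n}$ be $k$-closed over $\mathbb{Z}_{\ell}$. Then $|\mathcal{F}|\leq 2^{\lfloor n/\ell\rfloor}$. Also, if $|\mathcal{F}|> 2^{\lfloor n/\ell\rfloor-1}$, then $[n]$ can be partitioned into sets $A_{1},\dots,A_{d},A'$ (for some $d\ge 0$) such that $A_{i}$ is a maximal set of twins for $\mathcal{F}$ and $|A_{i}|=\ell$ for each $i\in [d]$, $|A'|\leq \ell-1$, and every $v\in\mathcal{F}$ vanishes on $A'$ (i.e. $v(j)=0$ for all $j\in A'$).
   Context: Vectors in $\{0,1\}^n$ are identified with elements of $\mathbb{Z}_\ell^n$ (and with characteristic vectors of subsets of $[n]$). For $v,w\in\mathbb{Z}_\ell^n$, $v\cdot w$ is the coordinatewise product, and for $\mathcal{F}\subset\mathbb{Z}_\ell^n$, $\mathcal{F}^i=\{v_1\cdot\ldots\cdot v_i: v_1,\dots,v_i\in\mathcal{F}\}$ (factors not necessarily distinct). Let $\|v\|=\sum_{j=1}^n v(j)\in\mathbb{Z}_\ell$. A set $\mathcal{F}\subset\mathbb{Z}_\ell^n$ is $k$-closed (over $\mathbb{Z}_\ell$) if $\|v\|=0$ for every $1\le i\le k$ and every $v\in\mathcal{F}^i$; for $\mathcal{F}\subset\{0,1\}^n$ this means that the intersection of any $k$ not necessarily distinct corresponding sets has size divisible by $\ell$. Two indices $a,b\in[n]$ are twins for $\mathcal{F}$ if $v(a)=v(b)$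 for all $v\in\mathcal{F}$ and $v(a)\ne0$ for some $v\in\mathcal{F}$; this is an equivalence relation on the indices not vanishing on all of $\mathcal{F}$, and a maximal set of twins is a full equivalence class. *)

theory Defs
  imports Complex_Main "HOL-Library.FuncSet" "HOL-Library.Disjoint_Sets"
begin

text \<open>
  A vector of length \<open>n\<close> is an extensional function on \<open>{1..n}\<close>. Entries in the integers modulo
  \<open>l\<close> are given by integer representatives and are reduced only when they are summed; for a
  0-1 vector the representatives 0 and 1 are kept distinct also when \<open>l = 1\<close>.
\<close>

definition cube :: "nat \<Rightarrow> (nat \<Rightarrow> int) set" where
  "cube n = {1..n} \<rightarrow>\<^sub>E {0, 1}"

definition products :: "nat \<Rightarrow> (nat \<Rightarrow> int) set \<Rightarrow> nat \<Rightarrow> (nat \<Rightarrow> int) set" where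
  "products n F i =
    {(\<lambda>j\<in>{1..n}. \<Prod>t=1..i. w t j) | w :: nat \<Rightarrow> nat \<Rightarrow> int. \<forall>t\<in>{1..i}. w t \<in> F}"

definition coord_sum :: "nat \<Rightarrow> nat \<Rightarrow> (nat \<Rightarrow> int) \<Rightarrow> int" where
  "coord_sum l n v = (\<Sum>j=1..n. v j) mod int l"

definition closed_family :: "nat \<Rightarrow> nat \<Rightarrow> nat \<Rightarrow> (nat \<Rightarrow> int) set \<Rightarrow> bool" where
  "closed_family l n k F \<longleftrightarrow> (\<forall>i\<in>{1..k}. \<forall>v\<in>products n F i. coord_sum l n v = 0)"

definition support :: "nat \<Rightarrow> (nat \<Rightarrow> int) set \<Rightarrow> nat set" where
  "support n F = {a \<in> {1..n}. \<exists>v\<in>F. v a \<noteq> 0}"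

definition twins :: "nat \<Rightarrow> (nat \<Rightarrow> int) set \<Rightarrow> (nat \<times> nat) set" where
  "twins n F = {(a, b). a \<in> {1..n} \<and> b \<in> {1..n} \<and> (\<forall>v\<in>F. v a = v b) \<and> (\<exists>v\<in>F. v a \<noteq> 0)}"

lemma equiv_twins: "equiv (support n F) (twins n F)"
  by (rule equivI) (auto simp: support_def twins_def refl_on_def sym_def trans_def, metis+)

definition maximal_twin_set :: "nat \<Rightarrow> (nat \<Rightarrow> int) set \<Rightarrow> nat set \<Rightarrow> bool" where
  "maximal_twin_set n F A \<longleftrightarrow> A \<in> support n F // twins n F"

end

theory Submission
  imports Defs "HOL-Number_Theory.Cong"
begin

text \<open>
  Fix a prime \<open>p\<close> and let \<open>V\<^sub>i\<close> be the span of the products of at most \<open>i\<close> members of \<open>F\<close>, as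
  functions modulo \<open>p\<close> on an index set \<open>X\<close>.  If \<open>dim V\<^bsub>2i+1\<^esub> < 2 dim V\<^sub>i\<close>, then \<open>V\<^bsub>2i\<^esub>\<close> contains the
  indicator function of a twin class.  So either such an indicator function occurs in bounded degree,
  or \<open>dim V\<^sub>1\<close> is at most a small fraction of the size of \<open>X\<close>, as the dimension doubles many times.

  Let \<open>p ^ a\<close> be the exact power of \<open>p\<close> dividing \<open>l\<close> and let \<open>X\<close> be the union of the twin classes whose
  size is not divisible by \<open>p ^ a\<close>.  If \<open>f \<in> V\<^bsub>2i\<^esub>\<close> is the indicator function of a class \<open>A\<close> on \<open>X\<close> modulo
  \<open>p\<close>, then \<open>f ^ p ^ (a - 1)\<close> is so modulo \<open>p ^ a\<close>; the classes outside \<open>X\<close> contribute multiples of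
  \<open>p ^ a\<close> to its coordinate sum, and \<open>k\<close>-closedness forces \<open>p ^ a\<close> to divide the size of \<open>A\<close>, a
  contradiction.  Hence \<open>F\<close> is determined by one index in each class of size divisible by \<open>l\<close> together
  with few indices from the other classes.
\<close>

section \<open>Integer spans of products of bounded length\<close>

text \<open>These are the spaces \<open>V\<^sub>i\<close> with integer coefficients, so that one
  function can be read modulo \<open>p\<close> and later modulo a power of \<open>p\<close>. The
  empty product is excluded: closedness says nothing about the constant 1, whose coordinate sum is
  \<open>n\<close>.\<close>

inductive_set poly_span :: "('a \<Rightarrow> int) set \<Rightarrow> nat \<Rightarrow> ('a \<Rightarrow> int) set"
  for F :: "('a \<Rightarrow> int) set" and i :: nat where
  monomial: "set vs \<subseteq> F \<Longrightarrow> vs \<noteq> [] \<Longrightarrow> length vs \<le> i \<Longrightarrow> (\<lambda>x. \<Prod>v\<leftarrow>vs. v x) \<in> poly_span F i"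
| zero: "(\<lambda>x. 0) \<in> poly_span F i"
| lincomb: "f \<in> poly_span F i \<Longrightarrow> g \<in> poly_span F i \<Longrightarrow> (\<lambda>x. c * f x + g x) \<in> poly_span F i"

lemma poly_span_mono: "f \<in> poly_span F i \<Longrightarrow> i \<le> j \<Longrightarrow> f \<in> poly_span F j"
  by (induction rule: poly_span.induct) (auto intro: poly_span.intros)

lemma poly_span_member: "v \<in> F \<Longrightarrow> i \<ge> 1 \<Longrightarrow> v \<in> poly_span F i"
  using poly_span.monomial[of "[v]" F i] by simp

lemma poly_span_scale: "f \<in> poly_span F i \<Longrightarrow> (\<lambda>x. c * f x) \<in> poly_span F i"
  using poly_span.lincomb[OF _ poly_span.zero] by fastforce

lemma poly_span_diff:
  assumes "f \<in> poly_span F i" "g \<in> poly_span F i"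
  shows "(\<lambda>x. f x - g x) \<in> poly_span F i"
  using poly_span.lincomb[OF assms(2,1), of "-1"] by (simp add: algebra_simps)

lemma poly_span_sum:
  "finite A \<Longrightarrow> (\<And>a. a \<in> A \<Longrightarrow> f a \<in> poly_span F i) \<Longrightarrow> (\<lambda>x. \<Sum>a\<in>A. c a * f a x) \<in> poly_span F i"
  by (induction rule: finite_induct) (auto intro: poly_span.intros)

lemma poly_span_mult:
  assumes "f \<in> poly_span F i" "g \<in> poly_span F j"
  shows "(\<lambda>x. f x * g x) \<in> poly_span F (i + j)"
  using assms
proof (induction rule: poly_span.induct)
  case (monomial vs)
  show ?case
    using monomial(4)
  proof (induction rule: poly_span.induct)
    case (monomial us)
    then show ?case
      using poly_span.monomial[of "vs @ us" F "i + j"] \<open>set vs \<subseteq> F\<close> \<open>vs \<noteq> []\<close> \<open>length vs \<le> i\<close>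
      by simp
  next
    case (lincomb f g c)
    then show ?case
      using poly_span.lincomb[OF lincomb(3,4), of c] by (simp add: algebra_simps)
  qed (simp add: poly_span.zero)
next
  case (lincomb f h c)
  then show ?case
    using poly_span.lincomb[of _ F "i + j" _ c] by (fastforce simp: algebra_simps)
qed (simp add: poly_span.zero)

lemma poly_span_power:
  assumes "f \<in> poly_span F i" "q > 0"
  shows "(\<lambda>x. f x ^ q) \<in> poly_span F (i * q)"
  using assms(2)
proof (induction q rule: nat_induct_non_zero)
  case (Suc q)
  then show ?case
    using poly_span_mult[OF assms(1) Suc(2)] by (simp add: algebra_simps)
qed (use assms in simp)

lemma poly_span_twin:
  "f \<in> poly_span F i \<Longrightarrow> (\<And>v. v \<in> F \<Longrightarrow> v x = v y) \<Longrightarrow> f x = f y"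
proof (induction rule: poly_span.induct)
  case (monomial vs)
  then have "map (\<lambda>v. v x) vs = map (\<lambda>v. v y) vs"
    by auto
  then show ?case
    by metis
qed auto

lemma poly_span_vanish:
  "f \<in> poly_span F i \<Longrightarrow> (\<And>v. v \<in> F \<Longrightarrow> v x = 0) \<Longrightarrow> f x = 0"
proof (induction rule: poly_span.induct)
  case (monomial vs)
  then show ?case
    by (cases vs) auto
qed auto

section \<open>Determining sets and dimension growth modulo a prime\<close>

text \<open>Restriction to \<open>T\<close> is injective modulo \<open>p\<close> on the span
  \<open>S\<close>. When \<open>S\<close> is one of the spans and \<open>X\<close> is finite, an
  inclusion-minimal such \<open>T\<close> inside \<open>X\<close> has as many elements as the
  dimension of \<open>S\<close> modulo \<open>p\<close> on \<open>X\<close>, so cardinalities of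
  determining sets stand in for dimensions.\<close>

definition determining :: "int \<Rightarrow> 'a set \<Rightarrow> ('a \<Rightarrow> int) set \<Rightarrow> 'a set \<Rightarrow> bool" where
  "determining p X S T \<longleftrightarrow> (\<forall>f\<in>S. (\<forall>x\<in>T. p dvd f x) \<longrightarrow> (\<forall>x\<in>X. p dvd f x))"

text \<open>A function showing that \<open>x\<close> cannot be dropped from \<open>T\<close> is a
  unit modulo \<open>p\<close> at \<open>x\<close>, because \<open>T\<close> itself determines;
  scaling by the inverse gives the dual vector.\<close>

lemma dual_vector:
  assumes p: "prime p" and T: "T \<subseteq> X" "determining p X (poly_span F i) T"
    and x: "x \<in> T" "\<not> determining p X (poly_span F i) (T - {x})"
  shows "\<exists>e\<in>poly_span F i. [e x = 1] (mod p) \<and> (\<forall>y\<in>T - {x}. p dvd e y)"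
proof -
  obtain f where f: "f \<in> poly_span F i" "\<forall>y\<in>T - {x}. p dvd f y" "\<not> (\<forall>y\<in>X. p dvd f y)"
    using x(2) by (auto simp: determining_def)
  with T(2) have "\<not> p dvd f x"
    by (auto simp: determining_def)
  then have "coprime (f x) p"
    using p by (simp add: coprime_commute prime_imp_coprime)
  then obtain c where "[f x * c = 1] (mod p)"
    using cong_solve_coprime_int by blast
  then show ?thesis
    using poly_span_scale[OF f(1), of c] f(2)
    by (intro bexI[of _ "\<lambda>y. c * f y"]) (auto simp: mult.commute)
qed

text \<open>Pigeonhole: there are more coefficient vectors on \<open>I\<close> than value vectors on
  \<open>J\<close>, and two coefficient vectors with the same values differ by a nontrivial
  relation.\<close>

lemma linear_dependence_mod:
  fixes c :: "'b \<Rightarrow> 'a \<Rightarrow> int" and p :: int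
  assumes p: "p > 1" and fin: "finite I" "finite J" and card: "card J < card I"
  shows "\<exists>\<alpha>. (\<exists>x\<in>I. \<not> p dvd \<alpha> x) \<and> (\<forall>y\<in>J. p dvd (\<Sum>x\<in>I. \<alpha> x * c x y))"
proof -
  let ?D = "I \<rightarrow>\<^sub>E {0..<p}" and ?R = "J \<rightarrow>\<^sub>E {0..<p}"
  let ?h = "\<lambda>\<alpha>. \<lambda>y\<in>J. (\<Sum>x\<in>I. \<alpha> x * c x y) mod p"
  have "nat p ^ card J < nat p ^ card I"
    using p card by (intro power_strict_increasing) auto
  then have less: "card ?R < card ?D"
    using fin by (simp add: card_PiE)
  have maps: "?h ` ?D \<subseteq> ?R"
    using p by auto
  have finR: "finite ?R"
    using fin by (intro finite_PiE) auto
  have "\<not> inj_on ?h ?D"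
  proof
    assume "inj_on ?h ?D"
    from card_inj_on_le[OF this maps finR] less show False
      by simp
  qed
  then obtain \<alpha> \<beta> where ab: "\<alpha> \<in> ?D" "\<beta> \<in> ?D" "\<alpha> \<noteq> \<beta>" "?h \<alpha> = ?h \<beta>"
    unfolding inj_on_def by blast
  then obtain x where x: "x \<in> I" "\<alpha> x \<noteq> \<beta> x"
    by (meson PiE_ext)
  have "\<alpha> x mod p = \<alpha> x" "\<beta> x mod p = \<beta> x"
    using ab x by (auto simp: PiE_iff)
  with x have "\<not> p dvd \<alpha> x - \<beta> x"
    by (metis mod_eq_dvd_iff)
  moreover have "p dvd (\<Sum>x\<in>I. (\<alpha> x - \<beta> x) * c x y)" if "y \<in> J" for y
    using fun_cong[OF ab(4), of y] that
    by (simp add: mod_eq_dvd_iff sum_subtractf left_diff_distrib)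
  ultimately show ?thesis
    using x(1) by (intro exI[of _ "\<lambda>x. \<alpha> x - \<beta> x"]) blast
qed

text \<open>
  A nonzero combination \<open>g\<close> of degree \<open>i\<close> supported on \<open>I\<close> inside \<open>T\<close>, multiplied by a vector dual
  to a point of its support, is a delta function on \<open>T\<close>.  As \<open>T\<close> still determines degree
  \<open>2 * i + 1\<close>, multiplication by any \<open>v \<in> F\<close> acts on this product as a scalar.
\<close>

lemma isolating_if_small_growth:
  fixes p :: int
  assumes p: "prime p" and X: "finite X" and T: "T \<subseteq> X" "determining p X (poly_span F (2 * i + 1)) T"
    and I: "I \<subseteq> T" "determining p X (poly_span F i) I"
      "\<And>x. x \<in> I \<Longrightarrow> \<not> determining p X (poly_span F i) (I - {x})"
    and card: "card T < 2 * card I"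
  shows "\<exists>x\<in>X. \<exists>w\<in>poly_span F (2 * i). [w x = 1] (mod p) \<and>
    (\<forall>y\<in>X. p dvd w y \<or> (\<forall>v\<in>F. [v y = v x] (mod p)))"
proof -
  have fin: "finite T" "finite I"
    using T(1) I(1) X by (auto intro: finite_subset)
  have p1: "p > 1"
    using p prime_gt_1_int by blast
  have "\<forall>x\<in>I. \<exists>e\<in>poly_span F i. [e x = 1] (mod p) \<and> (\<forall>y\<in>I - {x}. p dvd e y)"
    using dual_vector[OF p _ I(2)] I(1,3) T(1) by blast
  then obtain e where e: "\<And>x. x \<in> I \<Longrightarrow> e x \<in> poly_span F i"
    "\<And>x. x \<in> I \<Longrightarrow> [e x x = 1] (mod p)" "\<And>x y. x \<in> I \<Longrightarrow> y \<in> I \<Longrightarrow> y \<noteq> x \<Longrightarrow> p dvd e x y"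
    by (metis DiffI singletonD)
  \<comment> \<open>There are more dual vectors \<open>e z\<close> than points in
    \<open>T - I\<close>, so a combination that is nontrivial modulo \<open>p\<close> vanishes on
    all these points.\<close>
  have "card (T - I) < card I"
    using card I(1) fin by (simp add: card_Diff_subset)
  with linear_dependence_mod[OF p1, of I "T - I" e] fin
  obtain \<alpha> x where x: "x \<in> I" "\<not> p dvd \<alpha> x"
    and g0: "\<And>y. y \<in> T - I \<Longrightarrow> p dvd (\<Sum>z\<in>I. \<alpha> z * e z y)"
    by blast
  define g where "g = (\<lambda>y. \<Sum>z\<in>I. \<alpha> z * e z y)"
  have g: "g \<in> poly_span F i"
    unfolding g_def using e(1) fin by (intro poly_span_sum) auto
  have "p dvd (\<Sum>z\<in>I - {x}. \<alpha> z * e z x)"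
    using e(3) x by (intro dvd_sum) auto
  moreover have "g x = \<alpha> x * e x x + (\<Sum>z\<in>I - {x}. \<alpha> z * e z x)"
    unfolding g_def using x fin by (simp add: sum.remove)
  moreover have "\<not> p dvd e x x"
    using e(2)[OF x(1)] p by (metis cong_dvd_iff not_prime_unit)
  ultimately have "\<not> p dvd g x * e x x"
    using x(2) p by (simp add: prime_dvd_mult_iff dvd_add_left_iff)
  then have "coprime (g x * e x x) p"
    using p prime_imp_coprime coprime_commute by blast
  then obtain c where c: "[g x * e x x * c = 1] (mod p)"
    using cong_solve_coprime_int by blast
  define w where "w = (\<lambda>y. c * (g y * e x y))"
  have w: "w \<in> poly_span F (2 * i)"
    unfolding w_def mult_2 using poly_span_mult[OF g e(1)[OF x(1)]] by (intro poly_span_scale)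
  have wx: "[w x = 1] (mod p)"
    using c by (simp add: w_def mult_ac)
  have w0: "p dvd w y" if "y \<in> T - {x}" for y
    using that g0[of y] e(3)[OF x(1), of y] by (cases "y \<in> I") (auto simp: w_def g_def)
  have "[v y = v x] (mod p)" if v: "v \<in> F" and y: "y \<in> X" "\<not> p dvd w y" for v y
  proof -
    let ?h = "\<lambda>z. v z * w z - v x * w z"
    have "(\<lambda>z. v z * w z) \<in> poly_span F (1 + 2 * i)"
      by (rule poly_span_mult[OF poly_span_member[OF v order_refl] w])
    moreover have "(\<lambda>z. v x * w z) \<in> poly_span F (1 + 2 * i)"
      by (rule poly_span_mono[OF poly_span_scale[OF w]]) simp
    ultimately have "?h \<in> poly_span F (2 * i + 1)"
      using poly_span_diff by (metis add.commute)
    moreover have "\<forall>z\<in>T. p dvd ?h z"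
    proof
      fix z
      assume "z \<in> T"
      then show "p dvd ?h z"
        using w0[of z] by (cases "z = x") auto
    qed
    ultimately have "p dvd ?h y"
      using T(2) y(1) by (auto simp: determining_def)
    then have "p dvd (v y - v x) * w y"
      by (simp add: algebra_simps)
    with y(2) p show ?thesis
      by (simp add: prime_dvd_mult_iff cong_iff_dvd_diff)
  qed
  with w wx x(1) I(1) T(1) show ?thesis
    by blast
qed

text \<open>A determining subset of \<open>T\<close> of least size is irredundant. If it had more
  than half of the elements of \<open>T\<close>, the previous lemma would isolate a twin
  class.\<close>

lemma growth_or_isolating:
  fixes p :: int
  assumes p: "prime p" and X: "finite X" and T: "T \<subseteq> X" "determining p X (poly_span F (2 * i + 1)) T"
    and no: "\<not> (\<exists>x\<in>X. \<exists>w\<in>poly_span F (2 * i). [w x = 1] (mod p) \<and>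
      (\<forall>y\<in>X. p dvd w y \<or> (\<forall>v\<in>F. [v y = v x] (mod p))))"
  shows "\<exists>I\<subseteq>T. determining p X (poly_span F i) I \<and> 2 * card I \<le> card T"
proof -
  let ?P = "\<lambda>I. I \<subseteq> T \<and> determining p X (poly_span F i) I"
  have "?P T"
    using T(2) poly_span_mono[of _ F i "2 * i + 1"] by (auto simp: determining_def)
  then obtain I where I: "?P I" "\<And>J. ?P J \<Longrightarrow> card I \<le> card J"
    using ex_has_least_nat[of ?P T card] by blast
  have minimal: "\<not> determining p X (poly_span F i) (I - {x})" if "x \<in> I" for x
  proof
    assume "determining p X (poly_span F i) (I - {x})"
    with I have "card I \<le> card (I - {x})"
      by blast
    moreover have "finite I"
      using I(1) T(1) X by (meson finite_subset)
    ultimately show False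
      using that by (metis card_Diff1_less not_le)
  qed
  have "\<not> card T < 2 * card I"
  proof
    assume "card T < 2 * card I"
    from isolating_if_small_growth[OF p X T conjunct1[OF I(1)] conjunct2[OF I(1)] minimal this] no
    show False
      by contradiction
  qed
  with I(1) show ?thesis
    by (intro exI[of _ I]) auto
qed

text \<open>If no class is isolated, the halving step applies \<open>s\<close> times and leaves a
  small set that determines degree 1, hence differences of members of \<open>F\<close>.\<close>

lemma small_determining_or_isolating:
  fixes p :: int and F :: "('a \<Rightarrow> int) set"
  assumes p: "prime p" and X: "finite X" and "(\<Union>v\<in>F. v ` X) \<subseteq> {0, 1}"
  shows "(\<exists>T\<subseteq>X. 2 ^ s * card T \<le> card X \<and>
      (\<forall>u\<in>F. \<forall>v\<in>F. (\<forall>y\<in>T. u y = v y) \<longrightarrow> (\<forall>x\<in>X. u x = v x))) \<or>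
    (\<exists>x\<in>X. \<exists>f\<in>poly_span F (2 ^ Suc s).
      \<forall>y\<in>X. [f y = (if \<forall>v\<in>F. v y = v x then 1 else 0)] (mod p))"
proof -
  have F: "v x \<in> {0, 1}" if "v \<in> F" "x \<in> X" for v x
    using assms(3) that by blast
  show ?thesis
  proof (cases "\<exists>x\<in>X. \<exists>w\<in>poly_span F (2 ^ Suc s). [w x = 1] (mod p) \<and>
      (\<forall>y\<in>X. p dvd w y \<or> (\<forall>v\<in>F. [v y = v x] (mod p)))")
    case True
    then obtain x w where x: "x \<in> X" and w: "w \<in> poly_span F (2 ^ Suc s)" and wx: "[w x = 1] (mod p)"
      and wy: "\<And>y. y \<in> X \<Longrightarrow> p dvd w y \<or> (\<forall>v\<in>F. [v y = v x] (mod p))"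
      by blast
    \<comment> \<open>Values in {0, 1} that agree modulo a prime are equal, so nonvanishing of
      \<open>w\<close> modulo \<open>p\<close> already forces membership in the class of
      \<open>x\<close>.\<close>
    have eq: "v y = v x" if "[v y = v x] (mod p)" "v \<in> F" "y \<in> X" for v y
      using that F[of v y] F[of v x] x p by (auto simp: cong_iff_dvd_diff)
    have "[w y = (if \<forall>v\<in>F. v y = v x then 1 else 0)] (mod p)" if y: "y \<in> X" for y
    proof (cases "\<forall>v\<in>F. v y = v x")
      case True
      then show ?thesis
        using poly_span_twin[OF w, of y x] wx by auto
    next
      case False
      then show ?thesis
        using wy[OF y] eq y by (auto simp: cong_0_iff)
    qed
    with x w show ?thesis
      by blast
  next
    case False
    \<comment> \<open>The degrees \<open>2 ^ Suc r - 1\<close> are linked by i \<mapsto> 2i + 1. The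
      descent starts with \<open>X\<close> itself at r = s, and each step down halves the
      determining set.\<close>
    have "\<exists>T\<subseteq>X. determining p X (poly_span F (2 ^ Suc r - 1)) T \<and> 2 ^ (s - r) * card T \<le> card X"
      if "r \<le> s" for r
      using that
    proof (induction r rule: inc_induct)
      case base
      then show ?case
        by (intro exI[of _ X]) (auto simp: determining_def)
    next
      case (step r)
      then obtain T where T: "T \<subseteq> X" "determining p X (poly_span F (2 ^ Suc (Suc r) - 1)) T"
        "2 ^ (s - Suc r) * card T \<le> card X"
        by blast
      let ?i = "2 ^ Suc r - 1 :: nat"
      have i: "2 * ?i + 1 = 2 ^ Suc (Suc r) - 1"
      proof -
        have "(2::nat) ^ Suc r \<ge> 1"
          by simp
        then show ?thesis
          by (simp only: power_Suc[of 2 "Suc r"])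
      qed
      have "(2::nat) ^ Suc (Suc r) \<le> 2 ^ Suc s"
        using step(2) by (intro power_increasing) auto
      with i have "2 * ?i \<le> 2 ^ Suc s"
        by linarith
      with False poly_span_mono[of _ F "2 * ?i" "2 ^ Suc s"]
      have "\<not> (\<exists>x\<in>X. \<exists>w\<in>poly_span F (2 * ?i). [w x = 1] (mod p) \<and>
        (\<forall>y\<in>X. p dvd w y \<or> (\<forall>v\<in>F. [v y = v x] (mod p))))"
        by blast
      from growth_or_isolating[OF p X T(1) _ this] i T(2)
      obtain I where I: "I \<subseteq> T" "determining p X (poly_span F ?i) I" "2 * card I \<le> card T"
        by metis
      have "s - r = Suc (s - Suc r)"
        using step(2) by simp
      then have "2 ^ (s - r) * card I = 2 ^ (s - Suc r) * (2 * card I)"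
        by simp
      also have "\<dots> \<le> 2 ^ (s - Suc r) * card T"
        using I(3) by (intro mult_left_mono) auto
      finally show ?case
        using I T by (intro exI[of _ I]) auto
    qed
    from this[of 0] obtain T where T: "T \<subseteq> X" "determining p X (poly_span F 1) T"
      "2 ^ s * card T \<le> card X"
      by auto
    have "u x = v x" if uv: "u \<in> F" "v \<in> F" "\<forall>y\<in>T. u y = v y" "x \<in> X" for u v x
    proof -
      have "(\<lambda>y. u y - v y) \<in> poly_span F 1"
        using uv by (intro poly_span_diff poly_span_member) auto
      with T(2) uv(3,4) have "p dvd u x - v x"
        by (fastforce simp: determining_def)
      then show ?thesis
        using F[of u x] F[of v x] uv p by auto
    qed
    with T(1,3) show ?thesis
      by blast
  qed
qed

section \<open>Prime power moduli and coordinate sums\<close>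

text \<open>Each \<open>p\<close>-th power gains one factor \<open>p\<close>: in the factorization
  of \<open>c ^ p - d ^ p\<close> by \<open>c - d\<close>, the cofactor is a sum of \<open>p\<close>
  terms that are all congruent modulo \<open>p\<close>.\<close>

lemma cong_power_lift:
  fixes a b :: int
  assumes "[a = b] (mod int p)"
  shows "[a ^ (p ^ e) = b ^ (p ^ e)] (mod int p ^ Suc e)"
proof (induction e)
  case (Suc e)
  let ?c = "a ^ (p ^ e)" and ?d = "b ^ (p ^ e)"
  have "[?d ^ (p - Suc i) * ?c ^ i = ?c ^ (p - 1)] (mod int p)" if "i < p" for i
  proof -
    have "[?d ^ (p - Suc i) * ?c ^ i = ?c ^ (p - Suc i) * ?c ^ i] (mod int p)"
      using assms by (intro cong_mult cong_pow cong_refl) (rule cong_sym)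
    also have "?c ^ (p - Suc i) * ?c ^ i = ?c ^ (p - 1)"
      using that by (simp flip: power_add)
    finally show ?thesis .
  qed
  then have "[(\<Sum>i<p. ?d ^ (p - Suc i) * ?c ^ i) = (\<Sum>i<p. ?c ^ (p - 1))] (mod int p)"
    by (intro cong_sum) auto
  then have "int p dvd (\<Sum>i<p. ?d ^ (p - Suc i) * ?c ^ i)"
    by (simp add: cong_dvd_iff)
  moreover have "int p ^ Suc e dvd ?c - ?d"
    using Suc by (simp add: cong_iff_dvd_diff)
  ultimately have "int p ^ Suc e * int p dvd (?c - ?d) * (\<Sum>i<p. ?d ^ (p - Suc i) * ?c ^ i)"
    by (intro mult_dvd_mono) auto
  also have "\<dots> = ?c ^ p - ?d ^ p"
    by (rule power_diff_sumr2[symmetric])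
  finally show ?case
    by (simp add: cong_iff_dvd_diff mult_ac flip: power_mult)
qed (use assms in simp)

lemma closed_family_poly_span:
  assumes "closed_family l n k F" "f \<in> poly_span F k"
  shows "int l dvd (\<Sum>j=1..n. f j)"
  using assms(2)
proof (induction rule: poly_span.induct)
  case (monomial vs)
  \<comment> \<open>Factors are numbered from 1 in \<open>products\<close> and from 0 in a list,
    hence the shift.\<close>
  let ?m = "length vs" and ?w = "\<lambda>t. vs ! (t - 1)"
  let ?v = "\<lambda>j\<in>{1..n}. \<Prod>t=1..?m. ?w t j"
  have "?w t \<in> F" if "t \<in> {1..?m}" for t
    using that monomial(1) by (auto intro!: subsetD[OF monomial(1)] nth_mem)
  then have "?v \<in> products n F ?m"
    unfolding products_def mem_Collect_eq by (intro exI[of _ ?w] conjI refl ballI)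
  moreover have "?m \<in> {1..k}"
    using monomial by (cases vs) auto
  ultimately have "coord_sum l n ?v = 0"
    using assms(1) unfolding closed_family_def by blast
  then have "int l dvd (\<Sum>j=1..n. ?v j)"
    by (auto simp: coord_sum_def)
  moreover have "(\<Sum>j=1..n. ?v j) = (\<Sum>j=1..n. \<Prod>v\<leftarrow>vs. v j)"
  proof (rule sum.cong[OF refl])
    fix j
    assume "j \<in> {1..n}"
    then have "?v j = (\<Prod>t=1..?m. ?w t j)"
      by simp
    also have "\<dots> = (\<Prod>t<?m. (vs ! t) j)"
      by (rule prod.reindex_bij_witness[of _ Suc "\<lambda>t. t - 1"]) auto
    also have "\<dots> = (\<Prod>v\<leftarrow>vs. v j)"
      by (simp add: prod.list_conv_set_nth atLeast0LessThan)
    finally show "?v j = (\<Prod>v\<leftarrow>vs. v j)" .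
  qed
  ultimately show ?case
    by simp
next
  case (lincomb f g c)
  then show ?case
    by (simp add: sum.distrib flip: sum_distrib_left)
qed simp

section \<open>Twin classes\<close>

lemma finite_support: "finite (support n F)"
  by (simp add: support_def)

lemma finite_twin_classes:
  "finite (support n F // twins n F)" "B \<in> support n F // twins n F \<Longrightarrow> finite B"
  using finite_support[of n F] equiv_type[OF equiv_twins[of n F]]
  by (auto intro: finite_quotient finite_equiv_class)

lemma disjoint_twin_classes: "disjoint (support n F // twins n F)"
  using quotient_disj[OF equiv_twins] by (intro disjointI) blast

lemma card_Union_twin_classes:
  assumes "C \<subseteq> support n F // twins n F"
  shows "card (\<Union>C) = (\<Sum>B\<in>C. card B)"
  using assms finite_twin_classes(2) pairwise_subset[OF disjoint_twin_classes assms]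
  by (intro card_Union_disjoint) blast+

lemma twin_class_constant:
  assumes "B \<in> support n F // twins n F" "x \<in> B" "y \<in> B" "v \<in> F"
  shows "v x = v y"
  using quotient_eq_iff[OF equiv_twins assms(1,1,2,3)] assms(4) by (auto simp: twins_def)

lemma twin_class_Image:
  assumes "B \<in> support n F // twins n F" "x \<in> B"
  shows "twins n F `` {x} = B"
  using assms equiv_class_eq[OF equiv_twins] by (fastforce elim!: quotientE)

lemma sum_twin_classes:
  fixes f :: "nat \<Rightarrow> int"
  assumes "\<And>j. j \<in> {1..n} \<Longrightarrow> j \<notin> support n F \<Longrightarrow> f j = 0"
  shows "(\<Sum>j=1..n. f j) = (\<Sum>B\<in>support n F // twins n F. \<Sum>j\<in>B. f j)"
proof -
  have "(\<Sum>j=1..n. f j) = (\<Sum>j\<in>support n F. f j)"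
    using assms by (intro sum.mono_neutral_right) (auto simp: support_def)
  also have "\<dots> = (\<Sum>j\<in>\<Union>(support n F // twins n F). f j)"
    by (simp add: Union_quotient[OF equiv_twins])
  also have "\<dots> = (\<Sum>B\<in>support n F // twins n F. \<Sum>j\<in>B. f j)"
    using finite_twin_classes(2) disjointD[OF disjoint_twin_classes]
    by (subst sum.Union_disjoint) (blast | simp)+
  finally show ?thesis .
qed

lemma cube_01: "F \<subseteq> cube n \<Longrightarrow> v \<in> F \<Longrightarrow> x \<in> {1..n} \<Longrightarrow> v x \<in> {0, 1}"
  unfolding cube_def by blast

section \<open>Few indices suffice on the classes that are bad for a prime\<close>

text \<open>Closedness excludes the isolating alternative. The factor \<open>l\<close> in the bound
  on \<open>k\<close> pays for raising the isolating function to the power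
  \<open>p ^ (a - 1)\<close>, which is at most \<open>l\<close>.\<close>

lemma small_determining_prime_part:
  assumes F: "F \<subseteq> cube n" and closed: "closed_family l n k F" and l: "l > 0"
    and p: "prime p" "p dvd l" and k: "2 ^ Suc s * l \<le> k"
    and X: "X = {x \<in> support n F. \<not> p ^ multiplicity p l dvd card (twins n F `` {x})}"
  shows "\<exists>T\<subseteq>X. 2 ^ s * card T \<le> card X \<and>
    (\<forall>u\<in>F. \<forall>v\<in>F. (\<forall>y\<in>T. u y = v y) \<longrightarrow> (\<forall>x\<in>X. u x = v x))"
proof -
  have X_supp: "X \<subseteq> support n F" and X_n: "X \<subseteq> {1..n}"
    by (auto simp: X support_def)
  have p': "prime (int p)" and finX: "finite X"
    using p X_n by (auto intro: finite_subset)
  have X01: "(\<Union>v\<in>F. v ` X) \<subseteq> {0, 1}"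
    using X_n cube_01[OF F] by blast
  from small_determining_or_isolating[OF p' finX X01, of s] show ?thesis
  proof (rule disjE)
    assume "\<exists>x\<in>X. \<exists>f\<in>poly_span F (2 ^ Suc s).
      \<forall>y\<in>X. [f y = (if \<forall>v\<in>F. v y = v x then 1 else 0)] (mod int p)"
    then obtain x f where x: "x \<in> X" and f: "f \<in> poly_span F (2 ^ Suc s)"
      and f_mod: "\<And>y. y \<in> X \<Longrightarrow> [f y = (if \<forall>v\<in>F. v y = v x then 1 else 0)] (mod int p)"
      by blast
    let ?cls = "support n F // twins n F"
    define a where "a = multiplicity p l"
    define A where "A = twins n F `` {x}"
    define e where "e = p ^ (a - 1)"
    define g where "g = (\<lambda>j. f j ^ e)"
    have a: "a > 0" "int p ^ Suc (a - 1) = int p ^ a"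
      using p l by (auto simp: a_def prime_multiplicity_gt_zero_iff)
    have e: "e > 0" "e \<le> l"
    proof -
      show "e > 0"
        using p by (simp add: e_def prime_gt_0_nat)
      have "e dvd l"
        unfolding e_def a_def by (rule multiplicity_dvd') simp
      then show "e \<le> l"
        using l by (rule dvd_imp_le)
    qed
    have g: "g \<in> poly_span F k"
    proof -
      have "2 ^ Suc s * e \<le> 2 ^ Suc s * l"
        using e(2) by simp
      then show ?thesis
        unfolding g_def using poly_span_power[OF f e(1)] k
        by (blast intro: poly_span_mono order_trans)
    qed
    have gX: "[g y = (if \<forall>v\<in>F. v y = v x then 1 else 0)] (mod int p ^ a)" if "y \<in> X" for y
      using cong_power_lift[OF f_mod[OF that], of "a - 1", folded e_def] e(1) a
      by (auto simp: g_def zero_power split: if_splits)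
    have A: "A \<in> ?cls" "x \<in> A"
      using x X_supp equiv_class_self[OF equiv_twins]
      unfolding A_def by (blast intro: quotientI)+
    \<comment> \<open>\<open>g\<close> is constant on \<open>B\<close>. If \<open>B\<close> meets
      \<open>X\<close>, this constant is 1 or 0 modulo \<open>p ^ a\<close> according to whether B =
      A. Otherwise \<open>g\<close> is not controlled on \<open>B\<close>, but \<open>p ^ a\<close>
      divides the size of \<open>B\<close>.\<close>
    have "[(\<Sum>j\<in>B. g j) = (if B = A then int (card A) else 0)] (mod int p ^ a)" if B: "B \<in> ?cls" for B
    proof -
      obtain y where y: "y \<in> B"
        using in_quotient_imp_non_empty[OF equiv_twins B] by blast
      have "(\<Sum>j\<in>B. g j) = (\<Sum>j\<in>B. g y)"
        using poly_span_twin[OF g, of _ y] twin_class_constant[OF B _ y]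
        by (intro sum.cong) blast+
      then have sum: "(\<Sum>j\<in>B. g j) = int (card B) * g y"
        by simp
      have ySupp: "y \<in> support n F"
        using B y Union_quotient[OF equiv_twins[of n F]] by blast
      show ?thesis
      proof (cases "y \<in> X")
        case True
        have "(\<forall>v\<in>F. v y = v x) \<longleftrightarrow> B = A"
        proof
          assume "\<forall>v\<in>F. v y = v x"
          then have "(y, x) \<in> twins n F"
            using ySupp x X_n by (auto simp: twins_def support_def)
          then show "B = A"
            using quotient_eq_iff[OF equiv_twins B A(1) y A(2)] by blast
        next
          assume "B = A"
          then show "\<forall>v\<in>F. v y = v x"
            using twin_class_constant[OF B y] A(2) by blast
        qed
        then have "[g y = (if B = A then 1 else 0)] (mod int p ^ a)"
          using gX[OF True] by simp
        then have "[int (card B) * g y = int (card B) * (if B = A then 1 else 0)] (mod int p ^ a)"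
          by (intro cong_mult cong_refl)
        then show ?thesis
          by (auto simp: sum split: if_splits)
      next
        case False
        then have dvd: "p ^ a dvd card B"
          using ySupp by (simp add: X a_def twin_class_Image[OF B y])
        then have "int p ^ a dvd int (card B)"
          by (metis of_nat_dvd_iff of_nat_power)
        then show ?thesis
          by (auto simp: sum cong_iff_dvd_diff intro: dvd_diff)
      qed
    qed
    then have "[(\<Sum>B\<in>?cls. \<Sum>j\<in>B. g j) = (\<Sum>B\<in>?cls. if B = A then int (card A) else 0)] (mod int p ^ a)"
      by (rule cong_sum)
    also have "(\<Sum>B\<in>?cls. \<Sum>j\<in>B. g j) = (\<Sum>j=1..n. g j)"
      using poly_span_vanish[OF g] by (intro sum_twin_classes[symmetric]) (auto simp: support_def)
    finally have "[(\<Sum>j=1..n. g j) = int (card A)] (mod int p ^ a)"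
      using A(1) finite_twin_classes(1)[of n F] by simp
    moreover have "int p ^ a dvd (\<Sum>j=1..n. g j)"
    proof -
      have "int p ^ a dvd int l"
        unfolding a_def by (metis multiplicity_dvd of_nat_dvd_iff of_nat_power)
      then show ?thesis
        using closed_family_poly_span[OF closed g] dvd_trans by blast
    qed
    ultimately have "int p ^ a dvd int (card A)"
      by (simp add: cong_dvd_iff)
    then have "p ^ a dvd card A"
      by (metis of_nat_dvd_iff of_nat_power)
    \<comment> \<open>This contradicts the choice of \<open>x\<close> in \<open>X\<close>.\<close>
    with x show ?thesis
      by (simp add: X A_def a_def)
  qed
qed

section \<open>Counting and the extremal structure\<close>

text \<open>Off the support all members vanish, so agreement on \<open>R\<close> forces equality and
  restriction to \<open>R\<close> is injective.\<close>

lemma card_le_of_determining: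
  assumes F: "F \<subseteq> cube n" and R: "R \<subseteq> {1..n}"
    and det: "\<And>u v x. u \<in> F \<Longrightarrow> v \<in> F \<Longrightarrow> (\<And>y. y \<in> R \<Longrightarrow> u y = v y) \<Longrightarrow> x \<in> support n F \<Longrightarrow> u x = v x"
  shows "card F \<le> 2 ^ card R"
proof -
  have fin: "finite R"
    using R finite_subset by blast
  have "inj_on (\<lambda>v. restrict v R) F"
  proof (rule inj_onI)
    fix u v
    assume uv: "u \<in> F" "v \<in> F" "restrict u R = restrict v R"
    have eq: "u y = v y" if "y \<in> R" for y
      using fun_cong[OF uv(3), of y] that by simp
    have "u x = v x" if "x \<in> {1..n}" for x
    proof (cases "x \<in> support n F")
      case True
      then show ?thesis
        using det[OF uv(1,2)] eq by blast
    next
      case False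
      then show ?thesis
        using that uv(1,2) unfolding support_def by (metis (mono_tags, lifting) mem_Collect_eq)
    qed
    with F uv(1,2) show "u = v"
      unfolding cube_def by (intro PiE_ext[of u "{1..n}" _ v]) auto
  qed
  moreover have "restrict v R \<in> R \<rightarrow>\<^sub>E {0, 1::int}" if "v \<in> F" for v
    using cube_01[OF F that] R by (intro restrict_PiE_iff[THEN iffD2] ballI) blast
  then have "(\<lambda>v. restrict v R) ` F \<subseteq> R \<rightarrow>\<^sub>E {0, 1::int}"
    by blast
  moreover have "finite (R \<rightarrow>\<^sub>E {0, 1::int})"
    using fin by (intro finite_PiE) auto
  ultimately have "card F \<le> card (R \<rightarrow>\<^sub>E {0, 1::int})"
    by (rule card_inj_on_le)
  then show ?thesis
    using fin by (simp add: card_PiE numeral_2_eq_2)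
qed

theorem theorem3p3:
  fixes l :: nat
  assumes "l > 0"
  shows "\<exists>k::nat. k > 0 \<and>
    (\<forall>n::nat. n > 0 \<longrightarrow>
      (\<forall>F. F \<subseteq> cube n \<and> closed_family l n k F \<longrightarrow>
        card F \<le> 2 ^ (n div l) \<and>
        (real (card F) > 2 powi (int (n div l) - 1) \<longrightarrow>
          (\<exists>(d::nat) (A :: nat \<Rightarrow> nat set) (A' :: nat set).
            (\<Union>i\<in>{1..d}. A i) \<union> A' = {1..n} \<and>
            disjoint_family_on A {1..d} \<and>
            (\<forall>i\<in>{1..d}. A i \<inter> A' = {}) \<and>
            (\<forall>i\<in>{1..d}. maximal_twin_set n F (A i) \<and> card (A i) = l) \<and>
            card A' \<le> l - 1 \<and>
            (\<forall>v\<in>F. \<forall>j\<in>A'. v j = 0)))))"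
proof -
  \<comment> \<open>The bound 2 * l * l \<le> 2 ^ s splits into one factor \<open>l\<close> for the
    at most \<open>l\<close> primes dividing \<open>l\<close>, and a factor 2 * l, so that each
    index counted by \<open>\<tau>\<close> costs 2 * l indices of \<open>Y\<close>.\<close>
  define s where "s = 2 * l * l"
  define k where "k = 2 ^ Suc s * l"
  have s: "2 * l * l \<le> 2 ^ s"
    unfolding s_def by (rule less_imp_le[OF less_exp])
  have k: "k > 0"
    using assms by (simp add: k_def)
  show ?thesis
  proof (rule exI[of _ k], intro conjI[OF k] allI impI, elim conjE, intro conjI impI)
    fix n :: nat and F
    assume n: "n > 0" and F: "F \<subseteq> cube n" and closed: "closed_family l n k F"
    let ?cls = "support n F // twins n F"
    define X where "X = (\<lambda>p. {x \<in> support n F. \<not> p ^ multiplicity p l dvd card (twins n F `` {x})})"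
    define P where "P = prime_factors l"
    have P: "finite P" "card P \<le> l" "\<And>p. p \<in> P \<Longrightarrow> prime p \<and> p dvd l"
    proof -
      show "finite P" and prime: "\<And>p. p \<in> P \<Longrightarrow> prime p \<and> p dvd l"
        by (auto simp: P_def)
      have "P \<subseteq> {1..l}"
      proof
        fix p
        assume "p \<in> P"
        with prime have "prime p" "p dvd l"
          by auto
        then show "p \<in> {1..l}"
          using assms dvd_imp_le prime_gt_0_nat by fastforce
      qed
      then show "card P \<le> l"
        using card_mono[of "{1..l}" P] by simp
    qed
    have "\<forall>p\<in>P. \<exists>T\<subseteq>X p. 2 ^ s * card T \<le> card (X p) \<and>
      (\<forall>u\<in>F. \<forall>v\<in>F. (\<forall>y\<in>T. u y = v y) \<longrightarrow> (\<forall>x\<in>X p. u x = v x))"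
    proof
      fix p
      assume "p \<in> P"
      then have p: "prime p" "p dvd l"
        using P(3) by auto
      show "\<exists>T\<subseteq>X p. 2 ^ s * card T \<le> card (X p) \<and>
        (\<forall>u\<in>F. \<forall>v\<in>F. (\<forall>y\<in>T. u y = v y) \<longrightarrow> (\<forall>x\<in>X p. u x = v x))"
        by (rule small_determining_prime_part[OF F closed assms p]) (simp_all add: X_def k_def)
    qed
    from bchoice[OF this] obtain T where T': "\<forall>p\<in>P. T p \<subseteq> X p \<and> 2 ^ s * card (T p) \<le> card (X p) \<and>
        (\<forall>u\<in>F. \<forall>v\<in>F. (\<forall>y\<in>T p. u y = v y) \<longrightarrow> (\<forall>x\<in>X p. u x = v x))"
      by blast
    then have T: "\<And>p. p \<in> P \<Longrightarrow> T p \<subseteq> X p" "\<And>p. p \<in> P \<Longrightarrow> 2 ^ s * card (T p) \<le> card (X p)"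
      by blast+
    have T_det: "u x = v x"
      if "p \<in> P" "u \<in> F" "v \<in> F" "\<forall>y\<in>T p. u y = v y" "x \<in> X p" for p u v x
      using T' that by blast
    define C where "C = {B \<in> ?cls. l dvd card B}"
    define Y where "Y = (\<Union>p\<in>P. X p)"
    define \<tau> where "\<tau> = (\<Sum>p\<in>P. card (T p))"
    define rep where "rep = (\<lambda>B::nat set. SOME x. x \<in> B)"
    have C_cls: "C \<subseteq> ?cls" and finC: "finite C"
      using finite_twin_classes(1)[of n F] by (auto simp: C_def)
    have C_n: "\<Union>C \<subseteq> {1..n}"
      using C_cls Union_quotient[OF equiv_twins[of n F]] by (fastforce simp: support_def)
    have Y_n: "Y \<subseteq> {1..n}"
      by (auto simp: Y_def X_def support_def)
    have rep: "rep B \<in> B" if "B \<in> C" for B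
      using in_quotient_imp_non_empty[OF equiv_twins] that C_cls unfolding rep_def
      by (metis ex_in_conv someI_ex subsetD)
    have finB: "finite B" if "B \<in> C" for B
      using finite_twin_classes(2) that C_cls by blast
    have cardB: "l \<le> card B" if "B \<in> C" for B
    proof -
      have "card B > 0"
        using finB[OF that] rep[OF that] by (auto simp: card_gt_0_iff)
      then show ?thesis
        using that by (auto simp: C_def dest: dvd_imp_le)
    qed
    have cardC: "card (\<Union>C) = (\<Sum>B\<in>C. card B)"
      by (rule card_Union_twin_classes[OF C_cls])

    have bound: "card F \<le> 2 ^ (card C + \<tau>)"
    proof -
      \<comment> \<open>One index for each class of size divisible by \<open>l\<close>, together
        with the small sets for the primes. Any other class is bad for some prime \<open>p\<close>,
        hence lies in \<open>X p\<close>.\<close>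
      let ?R = "rep ` C \<union> (\<Union>p\<in>P. T p)"
      have "?R \<subseteq> {1..n}"
        using C_n Y_n rep T(1) unfolding Y_def by blast
      then have "card F \<le> 2 ^ card ?R"
      proof (rule card_le_of_determining[OF F])
        fix u v x
        assume uv: "u \<in> F" "v \<in> F" and eq: "\<And>y. y \<in> ?R \<Longrightarrow> u y = v y" and x: "x \<in> support n F"
        define B where "B = twins n F `` {x}"
        have B: "B \<in> ?cls" "x \<in> B"
          using x equiv_class_self[OF equiv_twins] unfolding B_def by (blast intro: quotientI)+
        show "u x = v x"
        proof (cases "l dvd card B")
          case True
          with B have "B \<in> C"
            by (simp add: C_def)
          then have "rep B \<in> B" "u (rep B) = v (rep B)"
            using rep eq by blast+
          then show ?thesis
            using twin_class_constant[OF B \<open>rep B \<in> B\<close> uv(1)] twin_class_constant[OF B \<open>rep B \<in> B\<close> uv(2)]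
            by simp
        next
          case False
          with assms obtain p where p: "prime p" "multiplicity p (card B) < multiplicity p l"
            using multiplicity_le_imp_dvd[of l "card B"] by (metis not_le less_not_refl)
          have "card B \<noteq> 0"
            using False by (metis dvd_0_right)
          with p have "\<not> p ^ multiplicity p l dvd card B"
            by (subst power_dvd_iff_le_multiplicity) (auto simp: prime_gt_1_nat)
          moreover have "p \<in> P"
            using p assms by (auto simp: P_def prime_factors_multiplicity)
          ultimately show ?thesis
            using T_det[OF _ uv, of p x] eq x by (auto simp: X_def B_def)
        qed
      qed
      also have "card ?R \<le> card C + \<tau>"
        unfolding \<tau>_def using card_Un_le[of "rep ` C" "\<Union>p\<in>P. T p"] card_image_le[OF finC, of rep]
          card_UN_le[OF P(1), of T] by linarith
      finally show ?thesis
        by simp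
    qed

    have l_C: "l * card C \<le> card (\<Union>C)"
      unfolding cardC using sum_bounded_below[of C l card] cardB by (simp add: mult.commute)
    \<comment> \<open>Summing the bounds on \<open>T p\<close> over the primes may count an index of
      \<open>Y\<close> up to \<open>l\<close> times; the spare factor \<open>l\<close> in
      \<open>2 ^ s\<close> absorbs this.\<close>
    have l_\<tau>: "2 * l * \<tau> \<le> card Y"
    proof -
      have "l * (2 * l * \<tau>) \<le> 2 ^ s * \<tau>"
        using mult_right_mono[OF s, of \<tau>] by (simp add: mult_ac)
      also have "\<dots> = (\<Sum>p\<in>P. 2 ^ s * card (T p))"
        by (simp add: \<tau>_def sum_distrib_left)
      also have "\<dots> \<le> (\<Sum>p\<in>P. card Y)"
      proof (rule sum_mono)
        fix p
        assume p: "p \<in> P"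
        then have "card (X p) \<le> card Y"
          using Y_n by (intro card_mono) (auto simp: Y_def intro: finite_subset)
        with T(2)[OF p] show "2 ^ s * card (T p) \<le> card Y"
          by linarith
      qed
      also have "\<dots> \<le> l * card Y"
        using P(2) by simp
      finally show ?thesis
        using assms by simp
    qed
    have disj: "\<Union>C \<inter> Y = {}"
    proof -
      have "x \<notin> X p" if "x \<in> B" "B \<in> C" for x B p
      proof -
        have "twins n F `` {x} = B"
          using that C_cls by (intro twin_class_Image) auto
        moreover have "p ^ multiplicity p l dvd card B"
          using that by (auto simp: C_def intro: dvd_trans[OF multiplicity_dvd])
        ultimately show ?thesis
          by (simp add: X_def)
      qed
      then show ?thesis
        by (auto simp: Y_def)
    qed
    have total: "card (\<Union>C) + card Y \<le> n"
    proof -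
      have "card (\<Union>C) + card Y = card (\<Union>C \<union> Y)"
        using disj C_n Y_n by (intro card_Un_disjoint[symmetric]) (auto intro: finite_subset)
      also have "\<dots> \<le> card {1..n}"
        using C_n Y_n by (intro card_mono) auto
      finally show ?thesis
        by simp
    qed
    have "l * (card C + \<tau>) \<le> n"
      using l_C l_\<tau> total by (simp add: algebra_simps)
    then have "card C + \<tau> \<le> n div l"
      using assms by (simp add: less_eq_div_iff_mult_less_eq mult.commute)
    then have "(2::nat) ^ (card C + \<tau>) \<le> 2 ^ (n div l)"
      by (rule power_increasing) simp
    with bound show "card F \<le> 2 ^ (n div l)"
      by linarith

    assume large: "real (card F) > 2 powi (int (n div l) - 1)"
    \<comment> \<open>Otherwise n div l is positive, so the truncated subtraction below is exact and
      \<open>bound\<close> contradicts \<open>large\<close>.\<close>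
    have "n div l \<le> card C + \<tau>"
    proof (rule ccontr)
      assume less: "\<not> ?thesis"
      have "real (card F) \<le> 2 ^ (card C + \<tau>)"
        using of_nat_mono[OF bound, where 'a = real] by simp
      also have "\<dots> \<le> 2 ^ (n div l - 1)"
        using less by (intro power_increasing) auto
      also have "\<dots> = 2 powi (int (n div l - 1))"
        by simp
      also have "int (n div l - 1) = int (n div l) - 1"
        using less by simp
      finally show False
        using large by simp
    qed
    moreover have "n < l * (n div l + 1)"
      using assms dividend_less_times_div[of l n] by simp
    moreover have "l * (n div l + 1) \<le> l * (card C + \<tau> + 1)" if "n div l \<le> card C + \<tau>"
      using that by (intro mult_left_mono) auto
    ultimately have n_less: "n < l * card C + l * \<tau> + l"
      by (simp add: algebra_simps)
    \<comment> \<open>Here the factor 2 in \<open>l_\<tau>\<close> matters: one copy of l * \<tau>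
      cancels and the other must stay below \<open>l\<close>, which forces \<tau> = 0.\<close>
    then have less: "card (\<Union>C) + l * \<tau> < l * card C + l"
      using l_\<tau> total by simp
    then have "l * \<tau> < l"
      using l_C by linarith
    then have \<tau>: "\<tau> = 0"
      by simp
    \<comment> \<open>A class of size at least 2 * l would use up \<open>l\<close> additional
      indices, which \<open>less\<close> does not allow.\<close>
    have card_l: "card B = l" if B: "B \<in> C" for B
    proof (rule ccontr)
      assume "card B \<noteq> l"
      moreover obtain m where m: "card B = l * m"
        using B by (auto simp: C_def)
      ultimately have "m \<ge> 2"
        using cardB[OF B] assms by (cases m rule: nat.exhaust; cases "m = 1") auto
      then have "2 * l \<le> card B"
        by (simp add: m)
      moreover have "l * card (C - {B}) \<le> (\<Sum>B\<in>C - {B}. card B)"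
        using sum_bounded_below[of "C - {B}" l card] cardB by (simp add: mult.commute)
      moreover have "(\<Sum>B\<in>C. card B) = card B + (\<Sum>B\<in>C - {B}. card B)"
        using finC B by (rule sum.remove)
      moreover have "l * card C = l * card (C - {B}) + l"
        by (subst card.remove[OF finC B]) simp
      ultimately show False
        using less cardC by linarith
    qed
    define A' where "A' = {1..n} - \<Union>C"
    have cardA': "card A' \<le> l - 1"
    proof -
      have "card A' = n - card (\<Union>C)"
        unfolding A'_def using C_n by (simp add: card_Diff_subset finite_subset)
      then show ?thesis
        using n_less \<tau> l_C by simp
    qed
    \<comment> \<open>Degree 1 closedness suffices: the classes in \<open>C\<close> contribute
      multiples of \<open>l\<close>, so the sum of \<open>v\<close> over \<open>A'\<close> is
      divisible by \<open>l\<close>. It is a sum of fewer than \<open>l\<close> values in {0, 1}, so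
      it is 0 and every term vanishes.\<close>
    have zero: "v j = 0" if v: "v \<in> F" and j: "j \<in> A'" for v j
    proof -
      have v01: "v i \<in> {0, 1}" if "i \<in> A'" for i
        using cube_01[OF F v] that by (simp add: A'_def)
      have "int l dvd (\<Sum>i=1..n. v i)"
        using v k by (intro closed_family_poly_span[OF closed] poly_span_member) auto
      also have "(\<Sum>i=1..n. v i) = (\<Sum>i\<in>A'. v i) + (\<Sum>i\<in>\<Union>C. v i)"
        unfolding A'_def using C_n by (intro sum.subset_diff) auto
      also have "(\<Sum>i\<in>\<Union>C. v i) = (\<Sum>B\<in>C. \<Sum>i\<in>B. v i)"
        using finB disjointD[OF pairwise_subset[OF disjoint_twin_classes C_cls]]
        by (subst sum.Union_disjoint) (blast | simp)+
      also have "\<dots> = (\<Sum>B\<in>C. int l * v (rep B))"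
      proof (rule sum.cong[OF refl])
        fix B
        assume B: "B \<in> C"
        then have "(\<Sum>i\<in>B. v i) = (\<Sum>i\<in>B. v (rep B))"
          using C_cls twin_class_constant[of B n F _ "rep B" v] rep[OF B] v by (intro sum.cong) auto
        then show "(\<Sum>i\<in>B. v i) = int l * v (rep B)"
          by (simp add: card_l[OF B])
      qed
      finally have "int l dvd (\<Sum>i\<in>A'. v i)"
        by (simp add: dvd_add_left_iff flip: sum_distrib_left)
      moreover have nonneg: "v i \<ge> 0" "v i \<le> 1" if "i \<in> A'" for i
        using v01[OF that] by auto
      moreover have "(\<Sum>i\<in>A'. v i) < int l"
      proof -
        have "(\<Sum>i\<in>A'. v i) \<le> int (card A')"
          using sum_bounded_above[of A' v 1] nonneg(2) by simp
        with cardA' assms show ?thesis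
          by linarith
      qed
      ultimately have "(\<Sum>i\<in>A'. v i) = 0"
        using sum_nonneg[of A' v] by (metis zdvd_not_zless order_le_less)
      moreover have "finite A'"
        by (simp add: A'_def)
      ultimately show ?thesis
        using sum_nonneg_eq_0_iff[of A' v] nonneg(1) j by blast
    qed
    obtain A where A: "bij_betw A {1..card C} C"
      using ex_bij_betw_nat_finite_1[OF finC] by blast
    then have A_C: "A i \<in> C" if "i \<in> {1..card C}" for i
      using that bij_betwE by blast
    have "(\<Union>i\<in>{1..card C}. A i) \<union> A' = {1..n}"
      using bij_betw_imp_surj_on[OF A] C_n by (auto simp: A'_def)
    moreover have "\<forall>i\<in>{1..card C}. A i \<inter> A' = {}"
      using A_C unfolding A'_def by blast
    moreover have "\<forall>i\<in>{1..card C}. maximal_twin_set n F (A i) \<and> card (A i) = l"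
      using A_C C_cls card_l unfolding maximal_twin_set_def by blast
    moreover have "disjoint_family_on A {1..card C}"
      unfolding disjoint_family_on_def
    proof (intro ballI impI)
      fix i j
      assume ij: "i \<in> {1..card C}" "j \<in> {1..card C}" "i \<noteq> j"
      then have "A i \<noteq> A j"
        using inj_onD[OF bij_betw_imp_inj_on[OF A]] by blast
      with A_C[OF ij(1)] A_C[OF ij(2)] show "A i \<inter> A j = {}"
        using disjointD[OF pairwise_subset[OF disjoint_twin_classes C_cls]] by blast
    qed
    moreover have "\<forall>v\<in>F. \<forall>j\<in>A'. v j = 0"
      using zero by blast
    ultimately show "\<exists>(d::nat) (A :: nat \<Rightarrow> nat set) (A' :: nat set).
            (\<Union>i\<in>{1..d}. A i) \<union> A' = {1..n} \<and>
            disjoint_family_on A {1..d} \<and>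
            (\<forall>i\<in>{1..d}. A i \<inter> A' = {}) \<and>
            (\<forall>i\<in>{1..d}. maximal_twin_set n F (A i) \<and> card (A i) = l) \<and>
            card A' \<le> l - 1 \<and>
            (\<forall>v\<in>F. \<forall>j\<in>A'. v j = 0)"
      using cardA' by (intro exI[of _ "card C"] exI[of _ A] exI[of _ A'] conjI) assumption+
  qed
qed

end
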